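(* Let $\mathcal{H}=(V,H)$ be a matroid of codimension $1$. Then every proper matroid extension of $\mathcal{H}$ equals $\mathcal{J}(T(H))=(V,J(T(H)))$; in particular $\mathcal{H}$ has at most one proper matroid extension.
   Context: A simplicial complex is a pair $(V,H)$ with $V$ finite nonempty, $H\subseteq 2^V$ containing all singletons and closed under subsets; its dimension is $\max\{|X|:X\in H\}-1$; it is a matroid if for all $I,J\in H$ with $|I|=|J|+1$ there is $i\in I\setminus J$ with $J\cup\{i\}\in H$ (matroids are boolean representable, hence truncations of boolean representable complexes). For a complex $(V,H)$ of dimension $d$, $T(H)=\{T\subseteq V \mid X\cup\{p\}\in H \text{ for all } X\in H\text{ with }|X|\le d,\ X\subseteq T,\text{ and all } p\in V\setminus T\}$; $T(H)$ is closed under intersection and contains $V$. For $R\subseteq 2^V$, $J(R)$ is the set of all sets $\{x_1,\dots,x_k\}$ for which there is a chain $F_0\subset\cdots\subset F_k$ in $R$ with $x_i\in F_i\setminus F_{i-1}$; $\mathcal{J}(R)=(V,J(R))$. The codimension of $\mathcal{H}$ is $\dim\mathcal{J}(T(H))-\dim\mathcal{H}$. An extension of $(V,H)$ (of dimension $d$) is a complex $(V,H')$ with $H'\cap P_{\le d+1}(V)=H$, where $P_{\le k}(V)$ is the set of subsets with at most $k$ elements; it is proper if $H'\ne H$. *)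

theory Defs
  imports Main
begin

definition simplicial_complex :: "'a set \<Rightarrow> 'a set set \<Rightarrow> bool" where
  "simplicial_complex V H \<longleftrightarrow>
     finite V \<and> V \<noteq> {} \<and> H \<subseteq> Pow V \<and> (\<forall>v\<in>V. {v} \<in> H) \<and>
     (\<forall>X\<in>H. \<forall>Y. Y \<subseteq> X \<longrightarrow> Y \<in> H)"

text \<open>Integer-valued, so that no truncated subtraction occurs here or in the codimension.\<close>

definition cdim :: "'a set set \<Rightarrow> int" where
  "cdim H = int (Max (card ` H)) - 1"

definition matroid :: "'a set \<Rightarrow> 'a set set \<Rightarrow> bool" where
  "matroid V H \<longleftrightarrow> simplicial_complex V H \<and>
     (\<forall>I\<in>H. \<forall>J\<in>H. card I = card J + 1 \<longrightarrow> (\<exists>i\<in>I - J. J \<union> {i} \<in> H))"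

definition T_sets :: "'a set \<Rightarrow> 'a set set \<Rightarrow> 'a set set" where
  "T_sets V H = {T. T \<subseteq> V \<and>
     (\<forall>X\<in>H. int (card X) \<le> cdim H \<and> X \<subseteq> T \<longrightarrow> (\<forall>p\<in>V - T. X \<union> {p} \<in> H))}"

text \<open>\<open>k = 0\<close> is allowed: a one-element chain yields the empty set.\<close>

definition J_sets :: "'a set set \<Rightarrow> 'a set set" where
  "J_sets R = {x ` {1..k} | (x :: nat \<Rightarrow> 'a) (k :: nat).
     \<exists>F :: nat \<Rightarrow> 'a set. (\<forall>i\<in>{0..k}. F i \<in> R) \<and>
       (\<forall>i\<in>{1..k}. F (i - 1) \<subset> F i \<and> x i \<in> F i - F (i - 1))}"

definition codimension :: "'a set \<Rightarrow> 'a set set \<Rightarrow> int" where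
  "codimension V H = cdim (J_sets (T_sets V H)) - cdim H"

definition extension :: "'a set \<Rightarrow> 'a set set \<Rightarrow> 'a set set \<Rightarrow> bool" where
  "extension V H H' \<longleftrightarrow> simplicial_complex V H' \<and>
     H' \<inter> {X. X \<subseteq> V \<and> int (card X) \<le> cdim H + 1} = H"

definition proper_extension :: "'a set \<Rightarrow> 'a set set \<Rightarrow> 'a set set \<Rightarrow> bool" where
  "proper_extension V H H' \<longleftrightarrow> extension V H H' \<and> H' \<noteq> H"

end

theory Submission
  imports Defs
begin

text \<open>
  Every flat of a matroid extension \<open>H'\<close> lies in \<open>T(H)\<close>, so \<open>H' \<subseteq> J(T(H))\<close>. Conversely, let
  \<open>C \<in> J(T(H))\<close> be dependent in \<open>H'\<close>. If \<open>d = dim H\<close>, codimension \<open>1\<close> gives \<open>|C| \<le> d + 2\<close>, so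
  \<open>C\<close> has rank at most \<open>d + 1\<close> in \<open>H'\<close> and its closure \<open>K\<close> is a proper flat. Intersecting a chain
  for \<open>C\<close> with \<open>K\<close> and appending \<open>V\<close> yields \<open>C \<union> {p} \<in> J(T(H))\<close> for any \<open>p \<notin> K\<close>; hence
  \<open>|C| \<le> d + 1\<close>. But the members of \<open>J(T(H))\<close> of size at most \<open>d + 1\<close> are already in \<open>H\<close>.
\<close>

section \<open>Transversals of chains\<close>

text \<open>\<open>chain_transversal R T A\<close>: \<open>A\<close> is obtained from a chain in \<open>R\<close> whose top element is \<open>T\<close>.\<close>

inductive chain_transversal :: "'a set set \<Rightarrow> 'a set \<Rightarrow> 'a set \<Rightarrow> bool" for R where
  empty: "T \<in> R \<Longrightarrow> chain_transversal R T {}"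
| step: "chain_transversal R S A \<Longrightarrow> T \<in> R \<Longrightarrow> S \<subset> T \<Longrightarrow> x \<in> T - S \<Longrightarrow>
    chain_transversal R T (insert x A)"

lemma chain_transversal_top_in: "chain_transversal R T A \<Longrightarrow> T \<in> R"
  by (induction rule: chain_transversal.induct) auto

lemma chain_transversal_subset_top: "chain_transversal R T A \<Longrightarrow> A \<subseteq> T"
  by (induction rule: chain_transversal.induct) auto

lemma chain_transversal_prefix:
  fixes k :: nat
  assumes "\<forall>i\<in>{0..k}. F i \<in> R"
    and "\<forall>i\<in>{1..k}. F (i - 1) \<subset> F i \<and> x i \<in> F i - F (i - 1)"
    and "j \<le> k"
  shows "chain_transversal R (F j) (x ` {1..j})"
  using assms(3)
proof (induction j)
  case 0
  then show ?case using assms(1) by (simp add: chain_transversal.empty)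
next
  case (Suc j)
  have "Suc j \<in> {1..k}" using Suc.prems by simp
  from assms(2)[rule_format, OF this]
  have "F j \<subset> F (Suc j)" "x (Suc j) \<in> F (Suc j) - F j" by simp_all
  moreover have "F (Suc j) \<in> R" using assms(1) Suc.prems by simp
  moreover have "chain_transversal R (F j) (x ` {1..j})" using Suc by simp
  ultimately have "chain_transversal R (F (Suc j)) (insert (x (Suc j)) (x ` {1..j}))"
    by (blast intro: chain_transversal.step)
  then show ?case by (simp add: atLeastAtMostSuc_conv)
qed

lemma chain_transversal_obtain_chain:
  assumes "chain_transversal R T A"
  obtains F x and k :: nat where "F k = T" "A = x ` {1..k}" "\<forall>i\<in>{0..k}. F i \<in> R"
    "\<forall>i\<in>{1..k}. F (i - 1) \<subset> F i \<and> x i \<in> F i - F (i - 1)"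
  using assms
proof (induction arbitrary: thesis rule: chain_transversal.induct)
  case (empty T)
  \<comment> \<open>With \<open>k = 0\<close> the constant map encodes the one-element chain
    \<open>T\<close>; the map \<open>x\<close> is never evaluated.\<close>
  show ?case by (rule empty.prems[of "\<lambda>_. T" 0]) (use empty.hyps in auto)
next
  case (step S A T y)
  obtain F x and k :: nat where ch: "F k = S" "A = x ` {1..k}" "\<forall>i\<in>{0..k}. F i \<in> R"
    "\<forall>i\<in>{1..k}. F (i - 1) \<subset> F i \<and> x i \<in> F i - F (i - 1)"
    by (rule step.IH)
  let ?F = "F(Suc k := T)" and ?x = "x(Suc k := y)"
  show ?case
  proof (rule step.prems[of ?F "Suc k" ?x])
    show "?F (Suc k) = T" by simp
    have "?x ` {1..Suc k} = insert (?x (Suc k)) (?x ` {1..k})"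
      by (simp only: atLeastAtMostSuc_conv[of 1 k] image_insert)
    also have "?x ` {1..k} = x ` {1..k}" by (intro image_cong) auto
    finally show "insert y A = ?x ` {1..Suc k}" using ch(2) by simp
    show "\<forall>i\<in>{0..Suc k}. ?F i \<in> R" using ch(3) step.hyps by auto
    show "\<forall>i\<in>{1..Suc k}. ?F (i - 1) \<subset> ?F i \<and> ?x i \<in> ?F i - ?F (i - 1)"
    proof
      fix i assume i: "i \<in> {1..Suc k}"
      show "?F (i - 1) \<subset> ?F i \<and> ?x i \<in> ?F i - ?F (i - 1)"
      proof (cases "i = Suc k")
        case True
        then show ?thesis using ch(1) step.hyps by simp
      next
        case False
        then have "i \<in> {1..k}" "i - 1 \<noteq> Suc k" using i by auto
        then show ?thesis using ch(4) False by simp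
      qed
    qed
  qed
qed

text \<open>Replaces indexed chains by a predicate that admits rule induction and keeps the top of
  the chain in view.\<close>

lemma J_sets_iff_chain_transversal: "A \<in> J_sets R \<longleftrightarrow> (\<exists>T. chain_transversal R T A)"
proof
  assume "A \<in> J_sets R"
  then show "\<exists>T. chain_transversal R T A"
    unfolding J_sets_def using chain_transversal_prefix by blast
next
  assume "\<exists>T. chain_transversal R T A"
  then obtain T where "chain_transversal R T A" ..
  then show "A \<in> J_sets R"
    by (rule chain_transversal_obtain_chain) (unfold J_sets_def, blast)
qed

text \<open>Strictness survives the intersection: each chosen element lies in \<open>K\<close>,
  hence still separates two consecutive members of the chain.\<close>

lemma chain_transversal_Int:
  assumes "chain_transversal R T A" "A \<subseteq> K" "\<And>S. S \<in> R \<Longrightarrow> S \<inter> K \<in> R"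
  shows "chain_transversal R (T \<inter> K) A"
  using assms(1,2)
proof (induction rule: chain_transversal.induct)
  case (empty T)
  then show ?case using assms(3) by (simp add: chain_transversal.empty)
next
  case (step S A T x)
  have "chain_transversal R (S \<inter> K) A" using step by simp
  moreover have "T \<inter> K \<in> R" using assms(3) step.hyps by simp
  moreover have x: "x \<in> T \<inter> K - S \<inter> K" using step.hyps step.prems by simp
  moreover have "S \<inter> K \<subset> T \<inter> K" using x step.hyps(3) by auto
  ultimately show ?case by (intro chain_transversal.step)
qed

section \<open>Flats of a matroid\<close>

text \<open>For independent \<open>I\<close> in a matroid this is the closure of \<open>I\<close>,
  the smallest flat containing it, expressed without a rank function.\<close>

definition indep_closure :: "'a set \<Rightarrow> 'a set set \<Rightarrow> 'a set \<Rightarrow> 'a set" where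
  "indep_closure V H I = I \<union> {v \<in> V. insert v I \<notin> H}"

lemma indep_subset: "simplicial_complex V H \<Longrightarrow> X \<in> H \<Longrightarrow> Y \<subseteq> X \<Longrightarrow> Y \<in> H"
  unfolding simplicial_complex_def by blast

lemma indep_finite: "simplicial_complex V H \<Longrightarrow> X \<in> H \<Longrightarrow> finite X"
  unfolding simplicial_complex_def by (meson PowD finite_subset subsetD)

lemma indep_subset_ground: "simplicial_complex V H \<Longrightarrow> X \<in> H \<Longrightarrow> X \<subseteq> V"
  unfolding simplicial_complex_def by auto

lemma matroid_complex: "matroid V H \<Longrightarrow> simplicial_complex V H"
  unfolding matroid_def by simp

text \<open>The exchange axiom covers a size gap of exactly one, so \<open>I\<close> is first shrunk
  to size \<open>card J + 1\<close>.\<close>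

lemma matroid_augment:
  assumes "matroid V H" "I \<in> H" "J \<in> H" "card J < card I"
  obtains i where "i \<in> I - J" "insert i J \<in> H"
proof -
  obtain I' where I': "I' \<subseteq> I" "card I' = card J + 1"
    using obtain_subset_with_card_n[of "card J + 1" I] assms(4) by auto
  have "I' \<in> H" using indep_subset[OF matroid_complex[OF assms(1)] assms(2) I'(1)] .
  then obtain i where "i \<in> I' - J" "J \<union> {i} \<in> H"
    using assms(1,3) I'(2) unfolding matroid_def by blast
  then show ?thesis using that I'(1) by auto
qed

lemma matroid_augment_to_card:
  assumes M: "matroid V H" and "I \<in> H" "X \<in> H" "card X \<le> card I"
  obtains Y where "Y \<in> H" "X \<subseteq> Y" "Y \<subseteq> X \<union> I" "card Y = card I"
  using assms(3,4)
proof (induction "card I - card X" arbitrary: X thesis)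
  case 0
  then show ?case by (intro "0.prems"(1)[of X]) auto
next
  case (Suc n)
  from Suc.hyps(2) have "card X < card I" by simp
  then obtain i where i: "i \<in> I - X" "insert i X \<in> H"
    using matroid_augment[OF M assms(2) Suc.prems(2)] by blast
  have "finite X" using indep_finite[OF matroid_complex[OF M] Suc.prems(2)] .
  then have card: "card (insert i X) = Suc (card X)" using i by simp
  obtain Y where "Y \<in> H" "insert i X \<subseteq> Y" "Y \<subseteq> insert i X \<union> I" "card Y = card I"
  proof (rule Suc.hyps(1)[of "insert i X"])
    show "n = card I - card (insert i X)" using Suc.hyps(2) card by simp
    show "insert i X \<in> H" by (rule i(2))
    show "card (insert i X) \<le> card I" using \<open>card X < card I\<close> card by simp
  qed
  then show ?case using Suc.prems(1)[of Y] i(1) by auto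
qed

text \<open>A larger \<open>X\<close> would, by exchange, supply an element outside \<open>I\<close>
  but in its closure that keeps \<open>I\<close> independent.\<close>

lemma card_le_of_subset_indep_closure:
  assumes "matroid V H" "I \<in> H" "X \<in> H" "X \<subseteq> indep_closure V H I"
  shows "card X \<le> card I"
proof (rule ccontr)
  assume "\<not> card X \<le> card I"
  then obtain x where "x \<in> X - I" "insert x I \<in> H"
    using matroid_augment[OF assms(1,3,2)] by auto
  then show False using assms(4) unfolding indep_closure_def by auto
qed

text \<open>Extend \<open>X\<close> by elements of \<open>insert p I\<close> to size
  \<open>card I + 1\<close>. The result is too large to fit in the closure of \<open>I\<close>, so
  it must contain \<open>p\<close>.\<close>

lemma insert_indep_outside_closure:
  assumes M: "matroid V H" and I: "I \<in> H" and X: "X \<in> H" "X \<subseteq> indep_closure V H I"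
    and p: "p \<in> V - indep_closure V H I"
  shows "insert p X \<in> H"
proof -
  have "p \<notin> I" "insert p I \<in> H" using p unfolding indep_closure_def by auto
  moreover have "finite I" using indep_finite[OF matroid_complex[OF M] I] .
  ultimately have card: "card (insert p I) = Suc (card I)" by simp
  have "card X \<le> card (insert p I)"
    using card_le_of_subset_indep_closure[OF M I X] card by simp
  then obtain Y where Y: "Y \<in> H" "X \<subseteq> Y" "Y \<subseteq> X \<union> insert p I" "card Y = Suc (card I)"
    using matroid_augment_to_card[OF M \<open>insert p I \<in> H\<close> X(1)] card by metis
  have "p \<in> Y"
  proof (rule ccontr)
    assume "p \<notin> Y"
    then have "Y \<subseteq> indep_closure V H I" using Y(3) X(2) unfolding indep_closure_def by auto
    then show False using card_le_of_subset_indep_closure[OF M I Y(1)] Y(4) by simp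
  qed
  then show ?thesis using indep_subset[OF matroid_complex[OF M] Y(1)] Y(2) by simp
qed

lemma indep_closure_subset_ground:
  "simplicial_complex V H \<Longrightarrow> I \<in> H \<Longrightarrow> indep_closure V H I \<subseteq> V"
  using indep_subset_ground unfolding indep_closure_def by blast

lemma indep_closure_mono:
  assumes "simplicial_complex V H" "I \<subseteq> J"
  shows "indep_closure V H I \<subseteq> indep_closure V H J"
proof
  fix v assume v: "v \<in> indep_closure V H I"
  have "insert v I \<in> H" if "insert v J \<in> H"
    using indep_subset[OF assms(1) that insert_mono[OF assms(2)]] .
  then show "v \<in> indep_closure V H J" using v assms(2) unfolding indep_closure_def by auto
qed

section \<open>The family \<open>T(H)\<close> and its transversals\<close>

lemma ground_in_T_sets: "V \<in> T_sets V H"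
  unfolding T_sets_def by simp

lemma T_sets_Int: "S \<in> T_sets V H \<Longrightarrow> T \<in> T_sets V H \<Longrightarrow> S \<inter> T \<in> T_sets V H"
  unfolding T_sets_def by blast

lemma J_T_sets_subset_ground:
  assumes "A \<in> J_sets (T_sets V H)"
  shows "A \<subseteq> V"
proof -
  obtain T where "chain_transversal (T_sets V H) T A"
    using assms J_sets_iff_chain_transversal by blast
  then show ?thesis
    using chain_transversal_subset_top chain_transversal_top_in unfolding T_sets_def by blast
qed

lemma card_le_cdim:
  assumes "finite V" "H \<subseteq> Pow V" "X \<in> H"
  shows "int (card X) \<le> cdim H + 1"
proof -
  have "finite (card ` H)" using assms(1,2) by (meson finite_Pow_iff finite_imageI finite_subset)
  then show ?thesis unfolding cdim_def using assms(3) by simp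
qed

text \<open>Induction along the chain: before its last element is added, the set has size at most
  \<open>cdim H\<close>, which is the range where membership of \<open>S\<close> in
  \<open>T_sets V H\<close> permits adding a point outside \<open>S\<close>.\<close>

lemma J_T_sets_small:
  assumes C: "simplicial_complex V H" and A: "A \<in> J_sets (T_sets V H)"
    and card: "int (card A) \<le> cdim H + 1"
  shows "A \<in> H"
proof -
  obtain T where "chain_transversal (T_sets V H) T A"
    using A J_sets_iff_chain_transversal by blast
  then show ?thesis using card
  proof (induction rule: chain_transversal.induct)
    case (empty T)
    then show ?case using C unfolding simplicial_complex_def by blast
  next
    case (step S A T x)
    have S: "A \<subseteq> S" "S \<in> T_sets V H"
      using chain_transversal_subset_top[OF step.hyps(1)] chain_transversal_top_in[OF step.hyps(1)]
      by simp_all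
    have x: "x \<in> V - S" using step.hyps(2,4) unfolding T_sets_def by auto
    have "A \<subseteq> V" using S unfolding T_sets_def by auto
    then have "finite A" using C finite_subset unfolding simplicial_complex_def by auto
    then have "card (insert x A) = Suc (card A)" using S(1) x by (auto simp: card_insert_if)
    then have "int (card A) \<le> cdim H" using step.prems by simp
    moreover from this have "A \<in> H" using step.IH by simp
    ultimately show ?case
      using S x unfolding T_sets_def by simp
  qed
qed

section \<open>Matroid extensions\<close>

text \<open>A point outside a flat of \<open>H'\<close> can be added within \<open>H'\<close>. The
  size bound in \<open>T_sets\<close> keeps the new set at \<open>cdim H + 1\<close> or below, where
  \<open>H\<close> and \<open>H'\<close> agree.\<close>

lemma indep_closure_in_T_sets:
  assumes M: "matroid V H'" and E: "extension V H H'" and I: "I \<in> H'"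
  shows "indep_closure V H' I \<in> T_sets V H"
proof -
  let ?K = "indep_closure V H' I"
  have eq: "H = H' \<inter> {X. X \<subseteq> V \<and> int (card X) \<le> cdim H + 1}"
    using E unfolding extension_def by simp
  have "X \<union> {p} \<in> H"
    if X: "X \<in> H" "int (card X) \<le> cdim H" "X \<subseteq> ?K" and p: "p \<in> V - ?K" for X p
  proof -
    have "X \<in> H'" using X(1) eq by blast
    then have "insert p X \<in> H'" using insert_indep_outside_closure[OF M I _ X(3) p] by simp
    moreover have "insert p X \<subseteq> V"
      using calculation indep_subset_ground[OF matroid_complex[OF M]] by blast
    moreover have "card (insert p X) \<le> Suc (card X)" by (rule card_insert_le_m1) simp_all
    then have "int (card (insert p X)) \<le> cdim H + 1" using X(2) by linarith
    ultimately have "insert p X \<in> H" by (subst eq) simp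
    then show ?thesis by simp
  qed
  then show ?thesis
    using indep_closure_subset_ground[OF matroid_complex[OF M] I] unfolding T_sets_def by blast
qed

text \<open>Adding the elements of \<open>Y\<close> one by one, the closures of the partial sets
  form a chain; it is strict because each new element is independent of the earlier ones.\<close>

lemma matroid_extension_subset_J:
  assumes M: "matroid V H'" and E: "extension V H H'"
  shows "H' \<subseteq> J_sets (T_sets V H)"
proof
  fix Y assume Y: "Y \<in> H'"
  note C = matroid_complex[OF M]
  have "finite Y" using indep_finite[OF C Y] .
  then have "chain_transversal (T_sets V H) (indep_closure V H' Y) Y" using Y
  proof (induction rule: finite_induct)
    case empty
    then show ?case using indep_closure_in_T_sets[OF M E] by (simp add: chain_transversal.empty)
  next
    case (insert y Y)
    have Y: "Y \<in> H'" using indep_subset[OF C insert.prems] by blast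
    have y: "y \<in> indep_closure V H' (insert y Y) - indep_closure V H' Y"
      using insert.hyps insert.prems unfolding indep_closure_def by auto
    show ?case
    proof (rule chain_transversal.step)
      show "chain_transversal (T_sets V H) (indep_closure V H' Y) Y" using insert.IH[OF Y] .
      show "indep_closure V H' (insert y Y) \<in> T_sets V H"
        using indep_closure_in_T_sets[OF M E insert.prems] .
      show "indep_closure V H' Y \<subset> indep_closure V H' (insert y Y)"
        using indep_closure_mono[OF C subset_insertI] y by blast
      show "y \<in> indep_closure V H' (insert y Y) - indep_closure V H' Y" by (rule y)
    qed
  qed
  then show "Y \<in> J_sets (T_sets V H)" using J_sets_iff_chain_transversal by blast
qed

lemma proper_extension_eq_J:
  assumes C: "simplicial_complex V H" and codim: "codimension V H = 1"
    and M: "matroid V H'" and P: "proper_extension V H H'"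
  shows "H' = J_sets (T_sets V H)"
proof
  let ?J = "J_sets (T_sets V H)"
  have E: "extension V H H'" and ne: "H' \<noteq> H" using P unfolding proper_extension_def by auto
  have eq: "H = H' \<inter> {X. X \<subseteq> V \<and> int (card X) \<le> cdim H + 1}"
    using E unfolding extension_def by simp
  note C' = matroid_complex[OF M]
  have fin: "finite V" using C unfolding simplicial_complex_def by simp
  show "H' \<subseteq> ?J" by (rule matroid_extension_subset_J[OF M E])
  show "?J \<subseteq> H'"
  proof (rule subsetI, rule ccontr)
    fix A assume A: "A \<in> ?J" and dep: "A \<notin> H'"
    have J_card: "int (card B) \<le> cdim H + 2" if "B \<in> ?J" for B
      using card_le_cdim[of V ?J B] fin J_T_sets_subset_ground that codim
      unfolding codimension_def by fastforce
    have AV: "A \<subseteq> V" and finA: "finite A"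
      using J_T_sets_subset_ground[OF A] fin finite_subset by auto
    \<comment> \<open>\<open>H\<close> and \<open>H'\<close> agree up to size
      \<open>cdim H + 1\<close>, so properness forces a larger member of \<open>H'\<close>.\<close>
    obtain Z where Z: "Z \<in> H'" "int (card Z) > cdim H + 1"
      using ne eq indep_subset_ground[OF C'] by fastforce
    have "{} \<in> H'" using indep_subset[OF C' Z(1)] by blast
    \<comment> \<open>\<open>I\<close> is a basis of \<open>A\<close> in \<open>H'\<close>;
      maximality puts all of \<open>A\<close> into its closure.\<close>
    then obtain I where I: "I \<in> H'" "I \<subseteq> A"
      and max: "\<forall>J\<in>{I \<in> H'. I \<subseteq> A}. I \<subseteq> J \<longrightarrow> I = J"
      using finite_has_maximal[of "{I \<in> H'. I \<subseteq> A}"] finA by auto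
    let ?K = "indep_closure V H' I"
    have "A \<subseteq> ?K"
    proof
      fix a assume "a \<in> A"
      then have "insert a I \<in> H' \<longrightarrow> I = insert a I" 
        using max[THEN bspec, of "insert a I"] I(2) by auto
      then show "a \<in> ?K" using \<open>a \<in> A\<close> AV unfolding indep_closure_def by auto
    qed
    have "I \<subset> A" using I dep by blast
    then have "card I < card A" using finA by (rule psubset_card_mono[rotated])
    \<comment> \<open>Here \<open>card I\<close> \<le> \<open>cdim H + 1\<close> <
      \<open>card Z\<close>, so exchange with \<open>Z\<close> yields a point \<open>p\<close>
      outside the closure of \<open>I\<close>.\<close>
    then have "card I < card Z" using J_card[OF A] Z(2) by linarith
    then obtain p where p: "p \<in> Z - I" "insert p I \<in> H'" by (rule matroid_augment[OF M Z(1) I(1)])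
    then have pV: "p \<in> V" and pK: "p \<notin> ?K"
      using indep_subset_ground[OF C' Z(1)] unfolding indep_closure_def by auto
    obtain T where T: "chain_transversal (T_sets V H) T A"
      using A J_sets_iff_chain_transversal by blast
    \<comment> \<open>Cutting the chain down to \<open>?K\<close> leaves room for \<open>V\<close>
      as a new top that contributes \<open>p\<close>.\<close>
    have "chain_transversal (T_sets V H) (T \<inter> ?K) A"
      by (rule chain_transversal_Int[OF T \<open>A \<subseteq> ?K\<close>])
        (rule T_sets_Int[OF _ indep_closure_in_T_sets[OF M E I(1)]])
    then have "chain_transversal (T_sets V H) V (insert p A)"
      using ground_in_T_sets pV pK indep_closure_subset_ground[OF C' I(1)]
      by (intro chain_transversal.step[of _ "T \<inter> ?K"]) auto
    then have "insert p A \<in> ?J" using J_sets_iff_chain_transversal by blast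
    moreover have "p \<notin> A" using pK \<open>A \<subseteq> ?K\<close> by blast
    \<comment> \<open>The bound \<open>cdim H + 2\<close> now applies to \<open>insert p A\<close>,
      which has one element more than \<open>A\<close>.\<close>
    ultimately have "int (card A) \<le> cdim H + 1"
      using J_card[of "insert p A"] finA by simp
    then have "A \<in> H" by (rule J_T_sets_small[OF C A])
    then show False using dep eq by blast
  qed
qed

theorem theorem10p1:
  fixes V :: "'a set" and H :: "'a set set"
  assumes "matroid V H"
    and "codimension V H = 1"
  shows "(\<forall>H'. matroid V H' \<and> proper_extension V H H' \<longrightarrow> H' = J_sets (T_sets V H)) \<and>
         (\<exists>\<^sub>\<le>\<^sub>1 H'. matroid V H' \<and> proper_extension V H H')"
  using proper_extension_eq_J[OF matroid_complex[OF assms(1)] assms(2)]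
  by (auto simp: Uniq_def)

end
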